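(* Let $G$ be a connected bipartite graph on $n\ge 3$ vertices. Then $\iota^i(G)\le n/3$.
   Context: Graphs are finite and simple. For a set $S$ of vertices of $G$, $N[S]$ denotes the closed neighborhood of $S$, i.e. $S$ together with all neighbors of vertices of $S$. A set $S\subseteq V(G)$ is an isolating set of $G$ if $G-N[S]$ contains no edge. An independent isolating set is an isolating set that is also an independent set. The independent isolation number $\iota^i(G)$ is the minimum size of an independent isolating set of $G$. *)

theory Defs
  imports Complex_Main "Graph_Theory.Graph_Theory"
begin

text \<open>
  Following the AFP entry Graph_Theory, a finite simple graph is a finite symmetric loop-free
  digraph without parallel arcs (locale \<^locale>\<open>graph\<close>): an undirected edge \<open>uv\<close> is the pair of
  arcs from \<open>u\<close> to \<open>v\<close> and from \<open>v\<close> to \<open>u\<close>, and adjacency is \<^const>\<open>dominates\<close>.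
\<close>

definition bipartite :: "('a, 'b) pre_digraph \<Rightarrow> bool" where
  "bipartite G \<longleftrightarrow> (\<exists>U V. verts G = U \<union> V \<and> U \<inter> V = {} \<and>
     (\<forall>u v. u \<rightarrow>\<^bsub>G\<^esub> v \<longrightarrow> (u \<in> U \<and> v \<in> V) \<or> (u \<in> V \<and> v \<in> U)))"

definition closed_nbhd :: "('a, 'b) pre_digraph \<Rightarrow> 'a set \<Rightarrow> 'a set" where
  "closed_nbhd G S = S \<union> {v. \<exists>u\<in>S. u \<rightarrow>\<^bsub>G\<^esub> v}"

definition isolating :: "('a, 'b) pre_digraph \<Rightarrow> 'a set \<Rightarrow> bool" where
  "isolating G S \<longleftrightarrow> S \<subseteq> verts G \<and> arcs (G \<restriction> (verts G - closed_nbhd G S)) = {}"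

definition independent_set :: "('a, 'b) pre_digraph \<Rightarrow> 'a set \<Rightarrow> bool" where
  "independent_set G S \<longleftrightarrow> S \<subseteq> verts G \<and> (\<forall>u\<in>S. \<forall>v\<in>S. \<not> u \<rightarrow>\<^bsub>G\<^esub> v)"

definition independent_isolation_number :: "('a, 'b) pre_digraph \<Rightarrow> nat" where
  "independent_isolation_number G = Min (card ` {S. isolating G S \<and> independent_set G S})"

text \<open>
  The minimum above is over a finite nonempty set, since every maximal independent set is isolating.
\<close>

lemma (in graph) finite_independent_isolating:
  "finite {S. isolating G S \<and> independent_set G S}"
  by (rule finite_subset[of _ "Pow (verts G)"]) (auto simp: isolating_def)

lemma (in graph) independent_isolating_exists:
  "\<exists>S. isolating G S \<and> independent_set G S"
proof -
  have "finite {S. independent_set G S}"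
    by (rule finite_subset[of _ "Pow (verts G)"]) (auto simp: independent_set_def)
  moreover have "{} \<in> {S. independent_set G S}"
    by (simp add: independent_set_def)
  ultimately obtain S where S: "independent_set G S"
    and max: "\<And>T. independent_set G T \<Longrightarrow> S \<subseteq> T \<Longrightarrow> S = T"
    using finite_has_maximal[of "{S. independent_set G S}"] by blast
  have "v \<in> closed_nbhd G S" if v: "v \<in> verts G" for v
  proof (rule ccontr)
    assume nv: "v \<notin> closed_nbhd G S"
    have "\<not> v \<rightarrow> v"
      using adj_not_same by blast
    moreover have "\<not> v \<rightarrow> u \<and> \<not> u \<rightarrow> v" if "u \<in> S" for u
      using nv that sym_arcs by (auto simp: closed_nbhd_def symmetric_def dest: symD)
    ultimately have "independent_set G (insert v S)"
      using S v unfolding independent_set_def by blast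
    with max have "v \<in> S" by blast
    with nv show False by (simp add: closed_nbhd_def)
  qed
  then have "verts G - closed_nbhd G S = {}" by blast
  then have "isolating G S"
    using S by (auto simp: isolating_def independent_set_def)
  with S show ?thesis by blast
qed

end

theory Submission
  imports Defs
begin

text \<open>
  The vertex set splits into three independent isolating sets, and the smallest of them has at
  most \<open>n / 3\<close> elements. The three sets are the classes of the distance from a root \<open>r\<close> modulo 3.

  In a bipartite graph the distances of adjacent vertices differ by exactly one
  (\<open>dist_from_adjacent\<close>), so every class is independent. A class is isolating if every
  edge \<open>uv\<close> has a vertex of that class in \<open>N[u] \<union> N[v]\<close>. If \<open>u\<close> is the end nearer to the root and
  \<open>u \<noteq> r\<close>, then \<open>v\<close>, \<open>u\<close> and the predecessor of \<open>u\<close> on a shortest path have three consecutive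
  distances, so they meet all three classes. Only the edges \<open>rv\<close> remain. They are harmless if \<open>v\<close>
  has a neighbour other than \<open>r\<close>, as it then lies at distance 2. So all that is needed is a
  root with no neighbour of degree one, and \<open>ex_root_without_pendant_neighbour\<close> provides it:
  if \<open>r\<close> has a neighbour \<open>v\<close> of degree one, then \<open>v\<close> itself is such a root, because in a
  connected graph on at least three vertices the two ends of an edge cannot both have degree one.
\<close>

text \<open>
  Distances are taken over powers of the adjacency relation, so that prolonging a path by one
  edge is just relational composition. Only vertices reachable from \<open>r\<close> have a meaningful value.
\<close>

definition dist_from :: "('a, 'b) pre_digraph \<Rightarrow> 'a \<Rightarrow> 'a \<Rightarrow> nat" where
  "dist_from G r v = (LEAST k. (r, v) \<in> arcs_ends G ^^ k)"

lemma dist_from_le: "(r, v) \<in> arcs_ends G ^^ k \<Longrightarrow> dist_from G r v \<le> k"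
  unfolding dist_from_def by (rule Least_le)

lemma (in graph) adjacent_sym: "u \<rightarrow> v \<Longrightarrow> v \<rightarrow> u"
  using sym_arcs by (auto simp: symmetric_def dest: symD)

lemma (in graph) dist_from_walk:
  assumes "connected G" "r \<in> verts G" "v \<in> verts G"
  shows "(r, v) \<in> arcs_ends G ^^ dist_from G r v"
proof -
  have "r \<rightarrow>\<^sup>* v"
    using assms symmetric_connected_imp_strongly_connected by (auto simp: strongly_connected_def)
  then have "(r, v) \<in> (arcs_ends G)\<^sup>*"
    unfolding reachable_def by (rule rtrancl_on_rtranclI)
  then obtain k where "(r, v) \<in> arcs_ends G ^^ k"
    using rtrancl_imp_relpow by blast
  then show ?thesis
    unfolding dist_from_def by (rule LeastI)
qed

lemma (in graph) dist_from_eq_0_iff: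
  assumes "connected G" "r \<in> verts G" "v \<in> verts G"
  shows "dist_from G r v = 0 \<longleftrightarrow> v = r"
proof
  show "v = r" if "dist_from G r v = 0"
    using dist_from_walk[OF assms] that by simp
  show "dist_from G r v = 0" if "v = r"
    using dist_from_le[of r v 0 G] that by simp
qed

lemma (in graph) dist_from_le_Suc:
  assumes "connected G" "r \<in> verts G" "u \<rightarrow> v"
  shows "dist_from G r v \<le> Suc (dist_from G r u)"
proof -
  have "(r, u) \<in> arcs_ends G ^^ dist_from G r u"
    using assms adj_in_verts dist_from_walk by blast
  then show ?thesis
    using assms(3) by (intro dist_from_le relpow_Suc_I) auto
qed

lemma (in graph) dist_from_predecessor:
  assumes "connected G" "r \<in> verts G" "v \<in> verts G" "v \<noteq> r"
  obtains p where "p \<rightarrow> v" "dist_from G r v = Suc (dist_from G r p)"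
proof -
  obtain k where k: "dist_from G r v = Suc k"
    using dist_from_eq_0_iff[OF assms(1-3)] assms(4) not0_implies_Suc by blast
  then have "(r, v) \<in> arcs_ends G ^^ Suc k"
    using dist_from_walk[OF assms(1-3)] by simp
  then obtain p where p: "(r, p) \<in> arcs_ends G ^^ k" "p \<rightarrow> v"
    by (rule relpow_Suc_E)
  have "dist_from G r p \<le> k"
    using p(1) by (rule dist_from_le)
  moreover have "Suc k \<le> Suc (dist_from G r p)"
    using dist_from_le_Suc[OF assms(1,2) p(2)] k by simp
  ultimately show thesis
    using that p(2) k by simp
qed

text \<open>
  A walk of length \<open>k\<close> changes sides \<open>k\<close> times, so adjacent vertices have distances of different
  parity, while these distances differ by at most one in any connected graph.
\<close>

lemma (in graph) dist_from_adjacent: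
  assumes "connected G" "bipartite G" "r \<in> verts G" "u \<rightarrow> v"
  shows "dist_from G r v = Suc (dist_from G r u) \<or> dist_from G r u = Suc (dist_from G r v)"
proof -
  obtain U where U: "\<And>x y. x \<rightarrow> y \<Longrightarrow> x \<in> U \<longleftrightarrow> y \<notin> U"
    using assms(2) unfolding bipartite_def by (metis disjoint_iff)
  have side: "(r, x) \<in> arcs_ends G ^^ k \<Longrightarrow> (x \<in> U \<longleftrightarrow> r \<in> U) \<longleftrightarrow> even k" for x k
  proof (induction k arbitrary: x)
    case (Suc k)
    then obtain y where "(r, y) \<in> arcs_ends G ^^ k" "y \<rightarrow> x"
      by (meson relpow_Suc_E)
    with Suc.IH U show ?case by (metis even_Suc)
  qed simp
  have "u \<in> verts G" "v \<in> verts G"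
    using assms(4) adj_in_verts by blast+
  then have "even (dist_from G r u) \<noteq> even (dist_from G r v)"
    using side dist_from_walk[OF assms(1,3)] U[OF assms(4)] by metis
  then have "dist_from G r u \<noteq> dist_from G r v"
    by metis
  then show ?thesis
    using dist_from_le_Suc[OF assms(1,3,4)]
      dist_from_le_Suc[OF assms(1,3) adjacent_sym[OF assms(4)]] by linarith
qed

lemma (in graph) ex_root_without_pendant_neighbour:
  assumes "connected G" "card (verts G) \<ge> 3"
  obtains r where "r \<in> verts G" "\<And>v. r \<rightarrow> v \<Longrightarrow> \<exists>w. v \<rightarrow> w \<and> w \<noteq> r"
proof -
  obtain r where r: "r \<in> verts G"
    using assms(2) by fastforce
  show thesis
  proof (cases "\<forall>v. r \<rightarrow> v \<longrightarrow> (\<exists>w. v \<rightarrow> w \<and> w \<noteq> r)")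
    case True
    with r that show thesis by blast
  next
    case False
    then obtain v where v: "r \<rightarrow> v" "\<And>w. v \<rightarrow> w \<Longrightarrow> w = r" by blast
    have "\<exists>w. r \<rightarrow> w \<and> w \<noteq> v"
    proof (rule ccontr)
      assume "\<not> ?thesis"
      \<comment> \<open>No walk can leave the pair of \<open>r\<close> and \<open>v\<close>, so it would be the whole vertex set.\<close>
      then have closed: "y \<in> {r, v}" if "x \<rightarrow> y" "x \<in> {r, v}" for x y
        using v(2) that by blast
      have "(r, x) \<in> arcs_ends G ^^ k \<Longrightarrow> x \<in> {r, v}" for x k
      proof (induction k arbitrary: x)
        case (Suc k)
        then obtain y where "(r, y) \<in> arcs_ends G ^^ k" "y \<rightarrow> x"
          by (meson relpow_Suc_E)
        with Suc.IH closed show ?case by blast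
      qed simp
      then have "verts G \<subseteq> {r, v}"
        using dist_from_walk[OF assms(1) r] by blast
      then have "card (verts G) \<le> card {r, v}"
        by (intro card_mono) auto
      also have "\<dots> \<le> 2"
        by (simp add: card_insert_if)
      finally show False using assms(2) by simp
    qed
    with v that[of v] adj_in_verts show thesis by blast
  qed
qed

definition dist_class :: "('a, 'b) pre_digraph \<Rightarrow> 'a \<Rightarrow> nat \<Rightarrow> 'a set" where
  "dist_class G r j = {v \<in> verts G. dist_from G r v mod 3 = j}"

lemma (in graph) independent_dist_class:
  assumes "connected G" "bipartite G" "r \<in> verts G"
  shows "independent_set G (dist_class G r j)"
proof -
  have "False" if "u \<rightarrow> v" "dist_from G r u mod 3 = j" "dist_from G r v mod 3 = j" for u v
    using dist_from_adjacent[OF assms that(1)] that(2,3) by (auto simp: mod_Suc split: if_splits)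
  then show ?thesis
    unfolding independent_set_def dist_class_def by blast
qed

lemma (in graph) isolatingI:
  assumes "S \<subseteq> verts G"
    and "\<And>u v. u \<rightarrow> v \<Longrightarrow> u \<in> closed_nbhd G S \<or> v \<in> closed_nbhd G S"
  shows "isolating G S"
  using assms(1) assms(2)[OF in_arcs_imp_in_arcs_ends] unfolding isolating_def by auto

text \<open>
  The ends of an edge and a suitable third vertex \<open>w\<close> adjacent to one of them have three
  consecutive distances, which cover all residues modulo 3. The third vertex is the predecessor
  of the end nearer to the root; at the root, which has no predecessor, the last assumption
  supplies a vertex at distance 2 instead.
\<close>

lemma (in graph) isolating_dist_class:
  assumes "connected G" "bipartite G" "r \<in> verts G" "j < 3"
    and root: "\<And>v. r \<rightarrow> v \<Longrightarrow> \<exists>w. v \<rightarrow> w \<and> w \<noteq> r"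
  shows "isolating G (dist_class G r j)"
proof (rule isolatingI)
  show "dist_class G r j \<subseteq> verts G"
    by (auto simp: dist_class_def)
next
  let ?d = "dist_from G r"
  let ?N = "closed_nbhd G (dist_class G r j)"
  have near: "u \<in> ?N \<or> v \<in> ?N" if uv: "u \<rightarrow> v" and d: "?d v = Suc (?d u)" for u v
  proof -
    have V: "u \<in> verts G" "v \<in> verts G"
      using uv adj_in_verts by blast+
    have "\<exists>w. (w \<rightarrow> u \<or> w \<rightarrow> v) \<and> {?d u mod 3, ?d v mod 3, ?d w mod 3} = {0, 1, 2}"
    proof (cases "u = r")
      case True
      with root uv obtain w where w: "v \<rightarrow> w" "w \<noteq> r" by blast
      have "w \<in> verts G"
        using w(1) adj_in_verts by blast
      then have "?d u = 0" "?d w \<noteq> 0"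
        using dist_from_eq_0_iff[OF assms(1,3)] True V(1) w(2) by simp_all
      then have "?d w = 2"
        using dist_from_adjacent[OF assms(1-3) w(1)] d by simp
      then show ?thesis
        using \<open>?d u = 0\<close> d adjacent_sym[OF w(1)] by auto
    next
      case False
      then obtain p where p: "p \<rightarrow> u" "?d u = Suc (?d p)"
        using dist_from_predecessor[OF assms(1,3) V(1)] by blast
      have "?d p mod 3 = 0 \<or> ?d p mod 3 = 1 \<or> ?d p mod 3 = 2" by presburger
      then have "{?d u mod 3, ?d v mod 3, ?d p mod 3} = {0, 1, 2}"
        using p(2) d by (elim disjE) (auto simp: mod_Suc)
      with p(1) show ?thesis by blast
    qed
    then obtain w where w: "w \<rightarrow> u \<or> w \<rightarrow> v" "{?d u mod 3, ?d v mod 3, ?d w mod 3} = {0, 1, 2}"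
      by blast
    have "j \<in> {0, 1, 2}"
      using assms(4) by auto
    then have "j = ?d u mod 3 \<or> j = ?d v mod 3 \<or> j = ?d w mod 3"
      unfolding w(2)[symmetric] by blast
    then show ?thesis
      using V w(1) adj_in_verts unfolding closed_nbhd_def dist_class_def by blast
  qed
  show "u \<in> ?N \<or> v \<in> ?N" if uv: "u \<rightarrow> v" for u v
    using dist_from_adjacent[OF assms(1-3) uv] near uv adjacent_sym[OF uv] by blast
qed

lemma (in graph) card_dist_classes:
  "(\<Sum>j<3. card (dist_class G r j)) = card (verts G)"
proof -
  have "(\<Union>j<3. dist_class G r j) = verts G"
    by (auto simp: dist_class_def)
  then show ?thesis
    by (subst card_UN_disjoint[symmetric]) (auto simp: dist_class_def)
qed

theorem theorem5:
  fixes G :: "('a, 'b) pre_digraph" and n :: nat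
  assumes "Digraph.graph G" and "Digraph_Component.connected G" and "bipartite G"
    and "card (verts G) = n" and "n \<ge> 3"
  shows "real (independent_isolation_number G) \<le> real n / 3"
proof -
  interpret graph G by fact
  have "card (verts G) \<ge> 3"
    using assms(4,5) by simp
  with assms(2) obtain r where r: "r \<in> verts G" "\<And>v. r \<rightarrow>\<^bsub>G\<^esub> v \<Longrightarrow> \<exists>w. v \<rightarrow>\<^bsub>G\<^esub> w \<and> w \<noteq> r"
    using ex_root_without_pendant_neighbour by blast
  have "independent_isolation_number G \<le> card (dist_class G r j)" if "j < 3" for j
    unfolding independent_isolation_number_def
    using finite_independent_isolating independent_dist_class[OF assms(2,3) r(1)]
      isolating_dist_class[OF assms(2,3) r(1) that r(2)]
    by (intro Min_le) auto
  then have "(\<Sum>j<3::nat. independent_isolation_number G) \<le> (\<Sum>j<3. card (dist_class G r j))"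
    by (intro sum_mono) auto
  then have "3 * independent_isolation_number G \<le> n"
    using card_dist_classes assms(4) by simp
  then show ?thesis by linarith
qed

end
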